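(* Let $L$ be an immersed bundle of $j$-stable $2$-planes in $\mathbb{C}^4$ with mean curvature sphere $S$, and suppose $q\in\Omega^1(\mathrm{End}_j(\underline{\mathbb{C}}^4/L,L))$ satisfies $Sq=*q=qS$. Then $L$ is a $q$-constrained Willmore surface if and only if either of the following (equivalent) equations is verified: (i) $d*\mathcal{N}_S+2\,d*q=0$; (ii) $d*(A+q)=0$; (iii) $d*(Q+q)=0$.
   Context: Quaternionic model of $S^4$. $\mathbb{H}^2$ is identified with $\mathbb{C}^4$; left multiplication by the quaternion $j$ gives a complex anti-linear $j:\mathbb{C}^4\to\mathbb{C}^4$, $j^2=-1$. Fix $\det\in\wedge^4(\mathbb{C}^4)^*\backslash\{0\}$ with $\overline{\det\circ\wedge^4j}=\det$ and $\det(v_1,v_2,jv_1,jv_2)>0$ whenever $v_1,v_2,jv_1,jv_2$ are linearly independent. $\wedge^2\mathbb{C}^4$ has real structure $\wedge^2j$ and metric $(v_1\wedge v_2,v_3\wedge v_4)=\det(v_1,v_2,v_3,v_4)$, which has signature $(5,1)$ on $\mathrm{Fix}(\wedge^2j)=\mathbb{R}^{5,1}$, so $\wedge^2\mathbb{C}^4=(\mathbb{R}^{5,1})^{\mathbb{C}}$. $j$-stable $2$-planes $L$ correspond to real null lines $\wedge^2L$, i.e. to points of $S^4\cong\mathbb{P}(\mathcal{L})$, $\mathcal{L}$ the non-zero null vectors of $\mathbb{R}^{5,1}$. $sl(\mathbb{C}^4)\cong o(\wedge^2\mathbb{C}^4)$ via $f\mapsto\hat f$, $\hat f(x\wedge y)=(fx)\wedge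 y+x\wedge(fy)$. $M$ is an oriented surface; $\underline{\mathbb{C}}^4=M\times\mathbb{C}^4$; $d$ denotes trivial flat connections. An immersed bundle of $j$-stable $2$-planes is a rank $2$ $j$-stable subbundle $L\subset\underline{\mathbb{C}}^4$ such that $\Lambda:=\wedge^2L:M\to\mathbb{P}(\mathcal{L})$ is an immersion (standing assumption: not contained in any proper subsphere of $S^4$). $M$ carries the conformal structure induced by $\Lambda$ (that of the metrics $(d_X\sigma,d_Y\sigma)$, $\sigma\in\Gamma(\Lambda)$ never-zero), with complex structure $J$, and $*\omega=-\omega\circ J$ on $1$-forms. The theory is local. Mean curvature sphere. Let $\delta:=\pi_{\underline{\mathbb{C}}^4/L}\circ d|_L$. The mean curvature sphere of $L$ is the unique $j$-commuting complex structure $S\in\Gamma(\mathrm{End}(\underline{\mathbb{C}}^4))$, $S^2=-I$, with $SL=L$, $(dS)L\subset L$, $*\delta=S\circ\delta=\delta\circ S|_L$ ($S$ also denoting the induced map of $\underline{\mathbb{C}}^4/L$) and $(S\,dS-*dS)L=0$. $\mathcal{N}_S:=\frac12S\,dS$, $\mathcal{D}_S:=d-\mathcal{N}_S$. The Hopf fields are $A=\frac12(\mathcal{N}_S-S*\mathcal{N}_S)$ and $Q=\frac12(\mathcal{N}_S+S*\mathcal{N}_S)$, so $\mathcal{N}_S=A+Q$, $*A=SA$, $*Q=-SQ$. $\mathrm{End}_j(\underline{\mathbb{C}}^4/L,L)$ is the bundle of $j$-commuting endomorphisms $q$ of $\underline{\mathbb{C}}^4$ with $qL=0$ and $\mathrm{Im}\,q\subset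 L$. $q$-constrained Willmore. For $q$ as in the claim, $L$ is a $q$-constrained Willmore surface if $d^{\mathcal{D}_S}q=0$ and $d^{\mathcal{D}_S}*\mathcal{N}_S=2[q\wedge*\mathcal{N}_S]$, where $[\mu\wedge\eta](X,Y)=[\mu_X,\eta_Y]-[\mu_Y,\eta_X]$ and $d^\nabla$ is the exterior derivative on endomorphism-valued forms. Under $sl(\mathbb{C}^4)\cong o(\wedge^2\mathbb{C}^4)$ this is the condition that $\hat q$ is a real $1$-form with values in $\Lambda\wedge\Lambda^{(1)}$ which is a multiplier to the constrained Willmore surface $\Lambda$. *)

theory Defs
  imports "HOL-Analysis.Analysis"
begin

section \<open>Smooth maps between open subsets of normed spaces\<close>

primrec Ck_on :: "nat \<Rightarrow> 'a::real_normed_vector set \<Rightarrow> ('a \<Rightarrow> 'b::real_normed_vector) \<Rightarrow> bool" where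
  "Ck_on 0 U f \<longleftrightarrow> continuous_on U f"
| "Ck_on (Suc k) U f \<longleftrightarrow>
     f differentiable_on U \<and> (\<forall>v. Ck_on k U (\<lambda>x. frechet_derivative f (at x) v))"

text \<open>Only used for open sets \<open>U\<close> of finite-dimensional spaces, where testing the iterated
  directional derivatives one direction at a time is the usual notion of \<open>C\<^sup>\<infinity>\<close>.\<close>

definition smooth_on :: "'a::real_normed_vector set \<Rightarrow> ('a \<Rightarrow> 'b::real_normed_vector) \<Rightarrow> bool" where
  "smooth_on U f \<longleftrightarrow> (\<forall>k. Ck_on k U f)"

section \<open>The quaternionic structure, the two-vectors and their metric\<close>

text \<open>The quaternionic plane is identified with \<open>\<complex>\<^sup>4\<close> by
  \<open>(z\<^sub>1, z\<^sub>2, z\<^sub>3, z\<^sub>4) \<mapsto> (z\<^sub>1 + z\<^sub>2 j, z\<^sub>3 + z\<^sub>4 j)\<close>, complex scalars acting from the left;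
  then \<open>j (a + b j) = - cnj b + cnj a j\<close>.\<close>

definition quatj :: "complex^4 \<Rightarrow> complex^4" where
  "quatj z = vector [- cnj (z$2), cnj (z$1), - cnj (z$4), cnj (z$3)]"

type_synonym four_form = "complex^4 \<Rightarrow> complex^4 \<Rightarrow> complex^4 \<Rightarrow> complex^4 \<Rightarrow> complex"

definition alternating_four_form :: "four_form \<Rightarrow> bool" where
  "alternating_four_form vol \<longleftrightarrow>
     (\<forall>x y z.
        Vector_Spaces.linear (*s) (*) (\<lambda>u. vol u x y z) \<and>
        Vector_Spaces.linear (*s) (*) (\<lambda>u. vol x u y z) \<and>
        Vector_Spaces.linear (*s) (*) (\<lambda>u. vol x y u z) \<and>
        Vector_Spaces.linear (*s) (*) (\<lambda>u. vol x y z u)) \<and>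
     (\<forall>w x y z. \<not> distinct [w, x, y, z] \<longrightarrow> vol w x y z = 0)"

definition admissible_det :: "four_form \<Rightarrow> bool" where
  "admissible_det vol \<longleftrightarrow>
     alternating_four_form vol \<and>
     (\<exists>w x y z. vol w x y z \<noteq> 0) \<and>
     (\<forall>w x y z. cnj (vol (quatj w) (quatj x) (quatj y) (quatj z)) = vol w x y z) \<and>
     (\<forall>v w. distinct [v, w, quatj v, quatj w] \<and> vec.independent {v, w, quatj v, quatj w} \<longrightarrow>
        vol v w (quatj v) (quatj w) \<in> \<real> \<and> Re (vol v w (quatj v) (quatj w)) > 0)"

text \<open>\<open>\<And>\<^sup>2\<complex>\<^sup>4\<close> is realised as the space of skew-symmetric matrices, the matrix \<open>\<sigma>\<close> standing for
  \<open>1/2 \<Sum>\<^sub>i\<^sub>k \<sigma>\<^sub>i\<^sub>k e\<^sub>i \<and> e\<^sub>k\<close>. The metric and \<open>\<And>\<^sup>2j\<close> are the bilinear, respectively anti-linear,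
  extensions of their values on decomposable elements.\<close>

definition wedge :: "complex^4 \<Rightarrow> complex^4 \<Rightarrow> complex^4^4" where
  "wedge v w = (\<chi> i k. v$i * w$k - v$k * w$i)"

definition wmetric :: "four_form \<Rightarrow> complex^4^4 \<Rightarrow> complex^4^4 \<Rightarrow> complex" where
  "wmetric vol \<sigma> \<tau> =
     (1/4) * (\<Sum>i\<in>UNIV. \<Sum>k\<in>UNIV. \<Sum>l\<in>UNIV. \<Sum>m\<in>UNIV.
        \<sigma>$i$k * \<tau>$l$m * vol (axis i 1) (axis k 1) (axis l 1) (axis m 1))"

definition wedge2_j :: "complex^4^4 \<Rightarrow> complex^4^4" where
  "wedge2_j \<sigma> = (\<chi> a b. (1/2) * (\<Sum>i\<in>UNIV. \<Sum>k\<in>UNIV.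
     cnj (\<sigma>$i$k) * wedge (quatj (axis i 1)) (quatj (axis k 1)) $ a $ b))"

definition R51 :: "(complex^4^4) set" where
  "R51 = {\<sigma>. transpose \<sigma> = - \<sigma> \<and> wedge2_j \<sigma> = \<sigma>}"

text \<open>For \<open>P\<close> a \<open>j\<close>-stable complex \<open>2\<close>-plane, the real null line of the corresponding point of \<open>S\<^sup>4\<close>.
  The real span below is all of \<open>\<And>\<^sup>2P\<close>, as the spanning set is closed under complex scalars.\<close>

definition real_line :: "(complex^4) set \<Rightarrow> (complex^4^4) set" where
  "real_line P = span {wedge v w | v w. v \<in> P \<and> w \<in> P} \<inter> R51"

text \<open>A proper subsphere of \<open>S\<^sup>4\<close> is cut out by a proper subspace \<open>W\<close> of \<open>\<real>\<^sup>5\<^sup>,\<^sup>1\<close> of signature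
  \<open>(k + 1, 1)\<close>: its points are the null lines contained in \<open>W\<close>.\<close>

definition proper_subsphere :: "four_form \<Rightarrow> (complex^4^4) set \<Rightarrow> bool" where
  "proper_subsphere vol W \<longleftrightarrow>
     subspace W \<and> W \<subset> R51 \<and>
     (\<exists>t\<in>W. Re (wmetric vol t t) < 0 \<and>
        (\<forall>\<sigma>\<in>W. wmetric vol \<sigma> t = 0 \<and> \<sigma> \<noteq> 0 \<longrightarrow> Re (wmetric vol \<sigma> \<sigma>) > 0))"

section \<open>Oriented surfaces\<close>

text \<open>A chart is a pair of a domain and a coordinate map; the surface is the whole type \<open>'m\<close>.\<close>

type_synonym 'm chart = "'m set \<times> ('m \<Rightarrow> real^2)"

abbreviation chart_inv :: "'m chart \<Rightarrow> real^2 \<Rightarrow> 'm" where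
  "chart_inv c \<equiv> inv_into (fst c) (snd c)"

text \<open>\<open>dd c f p v\<close> is \<open>d\<^sub>X f\<close> at \<open>p\<close> for the tangent vector \<open>X\<close> whose coordinates in the chart \<open>c\<close>
  are \<open>v\<close>. In particular \<open>dd c (snd c') p\<close> is the change of coordinates of tangent vectors.\<close>

definition dd :: "'m chart \<Rightarrow> ('m \<Rightarrow> 'b::real_normed_vector) \<Rightarrow> 'm \<Rightarrow> real^2 \<Rightarrow> 'b" where
  "dd c f p v = frechet_derivative (f \<circ> chart_inv c) (at (snd c p)) v"

definition oriented_surface ::
    "'m::{t2_space, second_countable_topology} chart set \<Rightarrow> bool" where
  "oriented_surface \<A> \<longleftrightarrow>
     (\<Union>c\<in>\<A>. fst c) = UNIV \<and>
     (\<forall>c\<in>\<A>. open (fst c) \<and> open (snd c ` fst c) \<and>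
        homeomorphism (fst c) (snd c ` fst c) (snd c) (chart_inv c)) \<and>
     (\<forall>c\<in>\<A>. \<forall>c'\<in>\<A>.
        smooth_on (snd c ` (fst c \<inter> fst c')) (snd c' \<circ> chart_inv c) \<and>
        (\<forall>p\<in>fst c \<inter> fst c'. det (matrix (dd c (snd c') p)) > 0))"

definition smooth_map ::
    "'m::topological_space chart set \<Rightarrow> 'm set \<Rightarrow> ('m \<Rightarrow> 'b::real_normed_vector) \<Rightarrow> bool" where
  "smooth_map \<A> W f \<longleftrightarrow>
     open W \<and> (\<forall>c\<in>\<A>. smooth_on (snd c ` (fst c \<inter> W)) (f \<circ> chart_inv c))"

section \<open>Differential forms\<close>

text \<open>A form is given by its representatives in the charts: \<open>\<omega> c p v\<close> is the value at \<open>p\<close> on the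
  tangent vector with coordinates \<open>v\<close> in the chart \<open>c\<close>. The fields of endomorphisms of the
  tangent bundle have the same type, with values again coordinates in the chart \<open>c\<close>.\<close>

type_synonym ('m, 'b) form1 = "'m chart \<Rightarrow> 'm \<Rightarrow> real^2 \<Rightarrow> 'b"
type_synonym ('m, 'b) form2 = "'m chart \<Rightarrow> 'm \<Rightarrow> real^2 \<Rightarrow> real^2 \<Rightarrow> 'b"
type_synonym mat4 = "complex^4^4"

definition one_form ::
    "'m::topological_space chart set \<Rightarrow> ('m, 'b::real_normed_vector) form1 \<Rightarrow> bool" where
  "one_form \<A> \<omega> \<longleftrightarrow>
     (\<forall>c\<in>\<A>. (\<forall>p\<in>fst c. linear (\<omega> c p)) \<and>
        (\<forall>v. smooth_on (snd c ` fst c) (\<lambda>x. \<omega> c (chart_inv c x) v))) \<and>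
     (\<forall>c\<in>\<A>. \<forall>c'\<in>\<A>. \<forall>p\<in>fst c \<inter> fst c'. \<forall>v. \<omega> c' p (dd c (snd c') p v) = \<omega> c p v)"

definition complex_structure ::
    "'m::topological_space chart set \<Rightarrow> ('m, real^2) form1 \<Rightarrow> bool" where
  "complex_structure \<A> J \<longleftrightarrow>
     (\<forall>c\<in>\<A>. (\<forall>p\<in>fst c. linear (J c p) \<and>
          (\<forall>v. J c p (J c p v) = - v) \<and>
          (\<forall>v. v \<noteq> 0 \<longrightarrow> det (vector [v, J c p v] :: real^2^2) > 0)) \<and>
        (\<forall>v. smooth_on (snd c ` fst c) (\<lambda>x. J c (chart_inv c x) v))) \<and>
     (\<forall>c\<in>\<A>. \<forall>c'\<in>\<A>. \<forall>p\<in>fst c \<inter> fst c'. \<forall>v.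
        J c' p (dd c (snd c') p v) = dd c (snd c') p (J c p v))"

definition star :: "('m, real^2) form1 \<Rightarrow> ('m, 'b::ab_group_add) form1 \<Rightarrow> ('m, 'b) form1" where
  "star J \<omega> = (\<lambda>c p v. - \<omega> c p (J c p v))"

definition commutator :: "mat4 \<Rightarrow> mat4 \<Rightarrow> mat4" where
  "commutator X Y = X ** Y - Y ** X"

definition bracket_wedge :: "('m, mat4) form1 \<Rightarrow> ('m, mat4) form1 \<Rightarrow> ('m, mat4) form2" where
  "bracket_wedge \<mu> \<eta> =
     (\<lambda>c p u v. commutator (\<mu> c p u) (\<eta> c p v) - commutator (\<mu> c p v) (\<eta> c p u))"

text \<open>Exterior derivatives are computed on coordinate vector fields with constant coefficients,
  whose Lie bracket vanishes.\<close>

definition ext_d :: "('m, 'b::real_normed_vector) form1 \<Rightarrow> ('m, 'b) form2" where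
  "ext_d \<omega> = (\<lambda>c p u v. dd c (\<lambda>x. \<omega> c x v) p u - dd c (\<lambda>x. \<omega> c x u) p v)"

text \<open>\<open>cov B\<close> is the connection on endomorphisms induced by the connection \<open>d + B\<close> on \<open>\<complex>\<^sup>4\<close>, and
  \<open>ext_cov B\<close> the corresponding exterior derivative of endomorphism-valued \<open>1\<close>-forms.\<close>

definition cov ::
    "('m, mat4) form1 \<Rightarrow> 'm chart \<Rightarrow> ('m \<Rightarrow> mat4) \<Rightarrow> 'm \<Rightarrow> real^2 \<Rightarrow> mat4" where
  "cov B c \<xi> p u = dd c \<xi> p u + commutator (B c p u) (\<xi> p)"

definition ext_cov :: "('m, mat4) form1 \<Rightarrow> ('m, mat4) form1 \<Rightarrow> ('m, mat4) form2" where
  "ext_cov B \<omega> = (\<lambda>c p u v. cov B c (\<lambda>x. \<omega> c x v) p u - cov B c (\<lambda>x. \<omega> c x u) p v)"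

definition eq_form2 ::
    "'m chart set \<Rightarrow> ('m, 'b) form2 \<Rightarrow> ('m, 'b) form2 \<Rightarrow> bool" where
  "eq_form2 \<A> \<Omega> \<Theta> \<longleftrightarrow> (\<forall>c\<in>\<A>. \<forall>p\<in>fst c. \<forall>u v. \<Omega> c p u v = \<Theta> c p u v)"

section \<open>Immersed bundles of \<open>j\<close>-stable planes\<close>

definition local_section ::
    "'m::topological_space chart set \<Rightarrow> ('m \<Rightarrow> 'b::real_normed_vector set) \<Rightarrow> 'm set
       \<Rightarrow> ('m \<Rightarrow> 'b) \<Rightarrow> bool" where
  "local_section \<A> E W s \<longleftrightarrow> smooth_map \<A> W s \<and> (\<forall>p\<in>W. s p \<in> E p)"

definition j_stable_plane_bundle ::
    "'m::topological_space chart set \<Rightarrow> ('m \<Rightarrow> (complex^4) set) \<Rightarrow> bool" where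
  "j_stable_plane_bundle \<A> L \<longleftrightarrow>
     (\<forall>p. vec.subspace (L p) \<and> vec.dim (L p) = 2 \<and> quatj ` L p \<subseteq> L p) \<and>
     (\<forall>p. \<exists>W s1 s2. p \<in> W \<and> local_section \<A> L W s1 \<and> local_section \<A> L W s2 \<and>
        (\<forall>x\<in>W. L x = vec.span {s1 x, s2 x}))"

text \<open>\<open>\<Lambda> = \<And>\<^sup>2L\<close> as a bundle of real null lines, its never-zero local sections \<open>\<sigma>\<close>, and the
  immersion condition for \<open>\<Lambda>\<close> as a map to the projective light-cone: the differential of \<open>\<Lambda>\<close> is
  \<open>X \<mapsto> (\<sigma> \<mapsto> d\<^sub>X\<sigma> mod \<Lambda>)\<close>.\<close>

definition Lam :: "('m \<Rightarrow> (complex^4) set) \<Rightarrow> 'm \<Rightarrow> (complex^4^4) set" where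
  "Lam L p = real_line (L p)"

definition lift_of_Lam ::
    "'m::topological_space chart set \<Rightarrow> ('m \<Rightarrow> (complex^4) set) \<Rightarrow> 'm set
       \<Rightarrow> ('m \<Rightarrow> complex^4^4) \<Rightarrow> bool" where
  "lift_of_Lam \<A> L W \<sigma> \<longleftrightarrow> local_section \<A> (Lam L) W \<sigma> \<and> (\<forall>p\<in>W. \<sigma> p \<noteq> 0)"

definition immersed_bundle ::
    "four_form \<Rightarrow> 'm::topological_space chart set \<Rightarrow> ('m \<Rightarrow> (complex^4) set) \<Rightarrow> bool" where
  "immersed_bundle vol \<A> L \<longleftrightarrow>
     j_stable_plane_bundle \<A> L \<and>
     (\<forall>W \<sigma>. lift_of_Lam \<A> L W \<sigma> \<longrightarrow>
        (\<forall>c\<in>\<A>. \<forall>p\<in>fst c \<inter> W. \<forall>v. dd c \<sigma> p v \<in> Lam L p \<longrightarrow> v = 0)) \<and>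
     \<not> (\<exists>V. proper_subsphere vol V \<and> (\<forall>p. Lam L p \<subseteq> V))"

definition induced_complex_structure ::
    "four_form \<Rightarrow> 'm::topological_space chart set \<Rightarrow> ('m \<Rightarrow> (complex^4) set)
       \<Rightarrow> ('m, real^2) form1 \<Rightarrow> bool" where
  "induced_complex_structure vol \<A> L J \<longleftrightarrow>
     complex_structure \<A> J \<and>
     (\<forall>W \<sigma>. lift_of_Lam \<A> L W \<sigma> \<longrightarrow>
        (\<forall>c\<in>\<A>. \<forall>p\<in>fst c \<inter> W. \<forall>u v.
           wmetric vol (dd c \<sigma> p (J c p u)) (dd c \<sigma> p (J c p v))
             = wmetric vol (dd c \<sigma> p u) (dd c \<sigma> p v)))"

section \<open>Mean curvature sphere, Hopf fields and constrained Willmore surfaces\<close>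

definition j_commuting :: "mat4 \<Rightarrow> bool" where
  "j_commuting X \<longleftrightarrow> (\<forall>v. X *v quatj v = quatj (X *v v))"

text \<open>The two conditions on a local section \<open>s\<close> of \<open>L\<close> are \<open>*\<delta> s = S (\<delta> s)\<close> and
  \<open>*\<delta> s = \<delta> (S s)\<close>, where \<open>\<delta>\<^sub>X s = d\<^sub>X s mod L\<close> and so \<open>*\<delta>\<^sub>X s = - d\<^bsub>JX\<^esub> s mod L\<close>.\<close>

definition mean_curvature_sphere ::
    "'m::topological_space chart set \<Rightarrow> ('m, real^2) form1 \<Rightarrow> ('m \<Rightarrow> (complex^4) set)
       \<Rightarrow> ('m \<Rightarrow> mat4) \<Rightarrow> bool" where
  "mean_curvature_sphere \<A> J L S \<longleftrightarrow>
     smooth_map \<A> UNIV S \<and>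
     (\<forall>p. j_commuting (S p) \<and> S p ** S p = - mat 1 \<and> (*v) (S p) ` L p = L p) \<and>
     (\<forall>c\<in>\<A>. \<forall>p\<in>fst c. \<forall>v. \<forall>x\<in>L p. dd c S p v *v x \<in> L p) \<and>
     (\<forall>W s. local_section \<A> L W s \<longrightarrow>
        (\<forall>c\<in>\<A>. \<forall>p\<in>fst c \<inter> W. \<forall>v.
           star J (\<lambda>c. dd c s) c p v - S p *v dd c s p v \<in> L p \<and>
           star J (\<lambda>c. dd c s) c p v - dd c (\<lambda>x. S x *v s x) p v \<in> L p)) \<and>
     (\<forall>c\<in>\<A>. \<forall>p\<in>fst c. \<forall>v. \<forall>x\<in>L p.
        (S p ** dd c S p v - star J (\<lambda>c. dd c S) c p v) *v x = 0)"

definition N_form :: "('m \<Rightarrow> mat4) \<Rightarrow> ('m, mat4) form1" where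
  "N_form S = (\<lambda>c p v. (1/2) *\<^sub>R (S p ** dd c S p v))"

definition hopf_A :: "('m, real^2) form1 \<Rightarrow> ('m \<Rightarrow> mat4) \<Rightarrow> ('m, mat4) form1" where
  "hopf_A J S = (\<lambda>c p v. (1/2) *\<^sub>R (N_form S c p v - S p ** star J (N_form S) c p v))"

definition hopf_Q :: "('m, real^2) form1 \<Rightarrow> ('m \<Rightarrow> mat4) \<Rightarrow> ('m, mat4) form1" where
  "hopf_Q J S = (\<lambda>c p v. (1/2) *\<^sub>R (N_form S c p v + S p ** star J (N_form S) c p v))"

text \<open>The exterior derivative for \<open>d - N\<^sub>S\<close>.\<close>

definition ext_D :: "('m \<Rightarrow> mat4) \<Rightarrow> ('m, mat4) form1 \<Rightarrow> ('m, mat4) form2" where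
  "ext_D S = ext_cov (\<lambda>c p v. - N_form S c p v)"

definition End_j_form ::
    "'m::topological_space chart set \<Rightarrow> ('m \<Rightarrow> (complex^4) set) \<Rightarrow> ('m, mat4) form1 \<Rightarrow> bool" where
  "End_j_form \<A> L q \<longleftrightarrow>
     one_form \<A> q \<and>
     (\<forall>c\<in>\<A>. \<forall>p\<in>fst c. \<forall>v. j_commuting (q c p v) \<and>
        (\<forall>x\<in>L p. q c p v *v x = 0) \<and> (\<forall>x. q c p v *v x \<in> L p))"

definition constrained_Willmore ::
    "'m chart set \<Rightarrow> ('m, real^2) form1 \<Rightarrow> ('m \<Rightarrow> mat4) \<Rightarrow> ('m, mat4) form1 \<Rightarrow> bool" where
  "constrained_Willmore \<A> J S q \<longleftrightarrow>
     eq_form2 \<A> (ext_D S q) (\<lambda>c p u v. 0) \<and>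
     eq_form2 \<A> (ext_D S (star J (N_form S)))
       (\<lambda>c p u v. 2 *\<^sub>R bracket_wedge q (star J (N_form S)) c p u v)"

section \<open>The extensions from decomposable two-vectors\<close>

lemma quatj_nth:
  "quatj z $ 1 = - cnj (z$2)" "quatj z $ 2 = cnj (z$1)"
  "quatj z $ 3 = - cnj (z$4)" "quatj z $ 4 = cnj (z$3)"
  by (simp_all add: quatj_def vector_def)

lemma wedge2_j_wedge: "wedge2_j (wedge v w) = wedge (quatj v) (quatj w)"
  by (simp add: vec_eq_iff wedge2_j_def wedge_def quatj_nth forall_4 sum_4 axis_def algebra_simps)

lemma linear_functional_expand:
  fixes f :: "complex^4 \<Rightarrow> complex"
  assumes "Vector_Spaces.linear (*s) (*) f"
  shows "f v = (\<Sum>i\<in>UNIV. v$i * f (axis i 1))"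
proof -
  interpret Vector_Spaces.linear "(*s)" "(*)" f by fact
  have "f v = f (\<Sum>i\<in>UNIV. v$i *s axis i 1)" by (simp add: basis_expansion)
  also have "\<dots> = (\<Sum>i\<in>UNIV. v$i * f (axis i 1))" by (simp add: sum scale)
  finally show ?thesis .
qed

lemma wmetric_wedge:
  assumes "alternating_four_form vol"
  shows "wmetric vol (wedge a b) (wedge c d) = vol a b c d"
proof -
  have l: "Vector_Spaces.linear (*s) (*) (\<lambda>u. vol u x y z)"
      "Vector_Spaces.linear (*s) (*) (\<lambda>u. vol x u y z)"
      "Vector_Spaces.linear (*s) (*) (\<lambda>u. vol x y u z)"
      "Vector_Spaces.linear (*s) (*) (\<lambda>u. vol x y z u)" for x y z
    using assms unfolding alternating_four_form_def by blast+
  have z: "vol x x y w = 0" "vol y w x x = 0" for x y w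
    using assms unfolding alternating_four_form_def by auto
  let ?V = "\<lambda>i k l m. vol (axis i 1) (axis k 1) (axis l 1) (axis m 1)"
  have e: "vol x y w t = (\<Sum>i\<in>UNIV. \<Sum>k\<in>UNIV. \<Sum>l\<in>UNIV. \<Sum>m\<in>UNIV.
      x$i * y$k * w$l * t$m * ?V i k l m)" for x y w t
  proof -
    have "vol x y w t = (\<Sum>i\<in>UNIV. x$i * vol (axis i 1) y w t)"
      by (rule linear_functional_expand[OF l(1)])
    also have "\<dots> = (\<Sum>i\<in>UNIV. x$i * (\<Sum>k\<in>UNIV. y$k * vol (axis i 1) (axis k 1) w t))"
      by (intro sum.cong refl arg_cong2[where f = "(*)"] linear_functional_expand[OF l(2)])
    also have "\<dots> = (\<Sum>i\<in>UNIV. x$i * (\<Sum>k\<in>UNIV. y$k * (\<Sum>l\<in>UNIV. w$l *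
        vol (axis i 1) (axis k 1) (axis l 1) t)))"
      by (intro sum.cong refl arg_cong2[where f = "(*)"] linear_functional_expand[OF l(3)])
    also have "\<dots> = (\<Sum>i\<in>UNIV. x$i * (\<Sum>k\<in>UNIV. y$k * (\<Sum>l\<in>UNIV. w$l *
        (\<Sum>m\<in>UNIV. t$m * ?V i k l m))))"
      by (intro sum.cong refl arg_cong2[where f = "(*)"] linear_functional_expand[OF l(4)])
    finally show ?thesis by (simp only: sum_distrib_left mult.assoc)
  qed
  note vadd = l[THEN Vector_Spaces.linear.axioms(3), THEN module_hom.add]
  have a1: "vol y x w t = - vol x y w t" for x y w t
  proof -
    have "0 = vol (x + y) (x + y) w t" by (simp only: z)
    also have "\<dots> = vol x y w t + vol y x w t" unfolding vadd(1) vadd(2) by (simp add: z)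
    finally show ?thesis by (simp add: eq_neg_iff_add_eq_0 add.commute)
  qed
  have a2: "vol w t y x = - vol w t x y" for x y w t
  proof -
    have "0 = vol w t (x + y) (x + y)" by (simp only: z)
    also have "\<dots> = vol w t x y + vol w t y x" unfolding vadd(3) vadd(4) by (simp add: z)
    finally show ?thesis by (simp add: eq_neg_iff_add_eq_0 add.commute)
  qed
  have sw: "(\<Sum>i\<in>UNIV. \<Sum>k\<in>UNIV. \<Sum>l\<in>UNIV. \<Sum>m\<in>UNIV.
        (x$i * y$k) * (w$l * t$m) * ?V i k l m) = vol x y w t" for x y w t
    unfolding e[of x y w t] by (simp only: mult.assoc)
  have t: "wedge a b $ i $ k * wedge c d $ l $ m * ?V i k l m =
      (a$i * b$k) * (c$l * d$m) * ?V i k l m - (b$i * a$k) * (c$l * d$m) * ?V i k l m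
      - ((a$i * b$k) * (d$l * c$m) * ?V i k l m - (b$i * a$k) * (d$l * c$m) * ?V i k l m)" for i k l m
    by (simp add: wedge_def algebra_simps)
  have "wmetric vol (wedge a b) (wedge c d) =
      (1/4) * (vol a b c d - vol b a c d - (vol a b d c - vol b a d c))"
    unfolding wmetric_def t by (simp only: sum_subtractf sw)
  then show ?thesis
    by (simp add: a1[of b a c d] a1[of b a d c] a2[of a b d c])
qed

end

theory Submission
  imports Defs
begin

text \<open>Put \<open>N = N\<^sub>S\<close>. The connection \<open>D = d - N\<close> makes \<open>S\<close> parallel, and \<open>[N \<and> *N] = 0\<close>, so
  \<open>d*N = d\<^sup>D*N\<close> while \<open>d*q = d\<^sup>D*q - [q \<and> *N]\<close>. Hence \<open>d*N + 2 d*q\<close> is the sum of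
  \<open>d\<^sup>D*N - 2[q \<and> *N]\<close>, which anti-commutes with \<open>S\<close>, and of \<open>2 d\<^sup>D*q = 2 S d\<^sup>Dq\<close>, which commutes
  with \<open>S\<close>; it vanishes if and only if both do. As \<open>SN = -1/2 dS\<close>, the forms \<open>*A\<close> and \<open>*Q\<close> differ
  from \<open>1/2 *N\<close> by multiples of the closed form \<open>dS\<close>, so the three equations agree up to a factor.\<close>

section \<open>Symmetry of second derivatives\<close>

text \<open>Mean value inequality: the second difference is the increment, as s runs from 0 to t, of
  the first difference in direction \<open>v\<close> based at \<open>x + s *\<^sub>R u\<close>. The
  s-derivative of that first difference is \<open>t *\<^sub>R G v\<close> up to two remainders of
  the first-order expansion of \<open>f' y u\<close> around \<open>x\<close>.\<close>

lemma second_difference_bound: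
  fixes f :: "'a::real_normed_vector \<Rightarrow> 'b::real_normed_vector"
  assumes "open U" "x \<in> U"
    and f: "\<And>y. y \<in> U \<Longrightarrow> (f has_derivative f' y) (at y)"
    and g: "((\<lambda>y. f' y u) has_derivative G) (at x)"
    and "e > 0"
  obtains d where "d > 0" "\<And>t. 0 < t \<Longrightarrow> t < d \<Longrightarrow>
    norm (f (x + t *\<^sub>R u + t *\<^sub>R v) - f (x + t *\<^sub>R u) - f (x + t *\<^sub>R v) + f x - t\<^sup>2 *\<^sub>R G v) \<le> e * t\<^sup>2"
proof -
  interpret G: bounded_linear G using g by (rule has_derivative_bounded_linear)
  \<comment> \<open>Every displacement below is \<open>s *\<^sub>R u + b *\<^sub>R v\<close> with s
    and b between 0 and t, hence of norm at most \<open>t * M\<close>. The summand 1 keeps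
    \<open>M\<close> positive when \<open>u\<close> and \<open>v\<close> vanish.\<close>
  define M where "M = norm u + norm v + 1"
  have M: "M > 0" by (simp add: M_def add_nonneg_pos)
  obtain r where r: "r > 0" "ball x r \<subseteq> U"
    using \<open>open U\<close> \<open>x \<in> U\<close> openE by blast
  \<comment> \<open>Two remainders of norm at most \<open>e / (2 * M) * (t * M)\<close> will add up
    to \<open>e * t\<close>.\<close>
  have "e / (2 * M) > 0" using M \<open>e > 0\<close> by simp
  then obtain d0 where d0: "d0 > 0"
    "\<And>y. norm (y - x) < d0 \<Longrightarrow> norm (f' y u - f' x u - G (y - x)) \<le> e / (2 * M) * norm (y - x)"
    using g unfolding has_derivative_at_alt by blast
  define d where "d = min d0 r / M"
  have "d > 0" using M d0(1) r(1) by (simp add: d_def)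
  moreover have "norm (f (x + t *\<^sub>R u + t *\<^sub>R v) - f (x + t *\<^sub>R u) - f (x + t *\<^sub>R v) + f x - t\<^sup>2 *\<^sub>R G v) \<le> e * t\<^sup>2"
    if t: "0 < t" "t < d" for t
  proof -
    have tM: "t * M < min d0 r" using t M by (simp add: d_def field_simps)
    have small: "norm (s *\<^sub>R u + b *\<^sub>R v) \<le> t * M" if "s \<in> {0..t}" "b \<in> {0..t}" for s b
    proof -
      have "norm (s *\<^sub>R u + b *\<^sub>R v) \<le> s * norm u + b * norm v"
        using that norm_triangle_ineq[of "s *\<^sub>R u" "b *\<^sub>R v"] by simp
      also have "\<dots> \<le> t * norm u + t * norm v"
        using that by (intro add_mono mult_right_mono) auto
      also have "\<dots> \<le> t * M" using t by (simp add: M_def algebra_simps)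
      finally show ?thesis .
    qed
    \<comment> \<open>With the linear term subtracted, the quantity to be bounded is exactly
      \<open>\<phi> t - \<phi> 0\<close>. The term \<open>0 *\<^sub>R v\<close> gives both base
      points the shape that \<open>small\<close> and \<open>inU\<close> handle.\<close>
    define \<phi> where "\<phi> s = f (x + (s *\<^sub>R u + t *\<^sub>R v)) - f (x + (s *\<^sub>R u + 0 *\<^sub>R v)) - (s * t) *\<^sub>R G v" for s
    have inU: "x + (s *\<^sub>R u + b *\<^sub>R v) \<in> U" if "s \<in> {0..t}" "b \<in> {0..t}" for s b
    proof (rule subsetD[OF r(2)])
      have "dist x (x + (s *\<^sub>R u + b *\<^sub>R v)) = norm (s *\<^sub>R u + b *\<^sub>R v)"
        by (metis add_diff_cancel_left' dist_commute dist_norm)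
      then show "x + (s *\<^sub>R u + b *\<^sub>R v) \<in> ball x r"
        using small[OF that] tM by simp
    qed
    have lin: "f' y (h *\<^sub>R u) = h *\<^sub>R f' y u" if "y \<in> U" for h y
      using f[OF that] by (simp add: has_derivative_def bounded_linear.linear linear_scale)
    let ?D = "\<lambda>s. f' (x + (s *\<^sub>R u + t *\<^sub>R v)) u - f' (x + (s *\<^sub>R u + 0 *\<^sub>R v)) u - t *\<^sub>R G v"
    have der: "(\<phi> has_derivative (\<lambda>h. h *\<^sub>R ?D s)) (at s within {0..t})" if s: "s \<in> {0..t}" for s
    proof -
      have 1: "((\<lambda>s. f (x + (s *\<^sub>R u + b *\<^sub>R v))) has_derivative
          (\<lambda>h. f' (x + (s *\<^sub>R u + b *\<^sub>R v)) (h *\<^sub>R u))) (at s within {0..t})" if "b \<in> {0..t}" for b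
        by (rule has_derivative_compose[where g = f and f = "\<lambda>s. x + (s *\<^sub>R u + b *\<^sub>R v)",
              OF _ f[OF inU[OF s that]]])
          (auto intro!: derivative_eq_intros)
      have "(\<phi> has_derivative (\<lambda>h. f' (x + (s *\<^sub>R u + t *\<^sub>R v)) (h *\<^sub>R u)
          - f' (x + (s *\<^sub>R u + 0 *\<^sub>R v)) (h *\<^sub>R u) - (h * t) *\<^sub>R G v)) (at s within {0..t})"
        unfolding \<phi>_def using t
        by (intro has_derivative_diff 1) (auto intro!: derivative_eq_intros)
      moreover have "f' (x + (s *\<^sub>R u + t *\<^sub>R v)) (h *\<^sub>R u)
          - f' (x + (s *\<^sub>R u + 0 *\<^sub>R v)) (h *\<^sub>R u) - (h * t) *\<^sub>R G v = h *\<^sub>R ?D s" for h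
        using t s by (simp only: lin inU atLeastAtMost_iff order_refl less_imp_le)
          (simp add: scaleR_diff_right)
      ultimately show ?thesis by simp
    qed
    have bd: "norm (?D s) \<le> e * t" if s: "s \<in> {0..t}" for s
    proof -
      have 1: "norm (f' (x + w) u - f' x u - G w) \<le> e / (2 * M) * (t * M)" if "norm w \<le> t * M" for w
      proof -
        have "norm (f' (x + w) u - f' x u - G w) \<le> e / (2 * M) * norm w"
          using d0(2)[of "x + w"] that tM by simp
        also have "\<dots> \<le> e / (2 * M) * (t * M)"
          using that M \<open>e > 0\<close> by (intro mult_left_mono) auto
        finally show ?thesis .
      qed
      \<comment> \<open>Insert \<open>f' x u\<close> in both terms; by linearity the two values of
        \<open>G\<close> differ by \<open>t *\<^sub>R G v\<close>.\<close>
      have "?D s = (f' (x + (s *\<^sub>R u + t *\<^sub>R v)) u - f' x u - G (s *\<^sub>R u + t *\<^sub>R v))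
          - (f' (x + (s *\<^sub>R u + 0 *\<^sub>R v)) u - f' x u - G (s *\<^sub>R u + 0 *\<^sub>R v))"
        by (simp add: G.add G.scaleR)
      also have "norm \<dots> \<le> e / (2 * M) * (t * M) + e / (2 * M) * (t * M)"
        using s t by (intro order_trans[OF norm_triangle_ineq4] add_mono 1 small) auto
      also have "\<dots> = e * t" using M by (simp add: field_simps)
      finally show ?thesis .
    qed
    have "norm (\<phi> t - \<phi> 0) \<le> (e * t) * norm (t - 0)"
    proof (rule differentiable_bound[OF _ der])
      show "onorm (\<lambda>h. h *\<^sub>R ?D s) \<le> e * t" if "s \<in> {0..t}" for s
        using bd[OF that] by (intro onorm_le) (simp add: mult.commute mult_left_mono)
    qed (use t in auto)
    moreover have "\<phi> t - \<phi> 0 =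
        f (x + t *\<^sub>R u + t *\<^sub>R v) - f (x + t *\<^sub>R u) - f (x + t *\<^sub>R v) + f x - t\<^sup>2 *\<^sub>R G v"
      by (simp add: \<phi>_def power2_eq_square add.assoc)
    ultimately show ?thesis using t by (simp add: power2_eq_square mult.assoc)
  qed
  ultimately show ?thesis using that by blast
qed

text \<open>No continuity of the second derivative is needed: the two iterated derivatives are both the
  limit of the same symmetric second difference quotient.\<close>

lemma second_derivative_symmetric:
  fixes f :: "'a::real_normed_vector \<Rightarrow> 'b::real_normed_vector"
  assumes "open U" "x \<in> U"
    and f: "\<And>y. y \<in> U \<Longrightarrow> (f has_derivative f' y) (at y)"
    and u: "((\<lambda>y. f' y u) has_derivative G) (at x)"
    and v: "((\<lambda>y. f' y v) has_derivative H) (at x)"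
  shows "G v = H u"
proof -
  have "norm (G v - H u) \<le> e" if "e > 0" for e :: real
  proof -
    have "e / 2 > 0" using that by simp
    obtain d1 where d1: "d1 > 0" "\<And>t. 0 < t \<Longrightarrow> t < d1 \<Longrightarrow>
      norm (f (x + t *\<^sub>R u + t *\<^sub>R v) - f (x + t *\<^sub>R u) - f (x + t *\<^sub>R v) + f x - t\<^sup>2 *\<^sub>R G v) \<le> e / 2 * t\<^sup>2"
      using second_difference_bound[OF assms(1,2) f u \<open>e / 2 > 0\<close>] by metis
    obtain d2 where d2: "d2 > 0" "\<And>t. 0 < t \<Longrightarrow> t < d2 \<Longrightarrow>
      norm (f (x + t *\<^sub>R v + t *\<^sub>R u) - f (x + t *\<^sub>R v) - f (x + t *\<^sub>R u) + f x - t\<^sup>2 *\<^sub>R H u) \<le> e / 2 * t\<^sup>2"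
      using second_difference_bound[OF assms(1,2) f v \<open>e / 2 > 0\<close>] by metis
    define t where "t = min d1 d2 / 2"
    have t: "0 < t" "t < d1" "t < d2" using d1(1) d2(1) by (auto simp: t_def)
    let ?a = "f (x + t *\<^sub>R u + t *\<^sub>R v) - f (x + t *\<^sub>R u) - f (x + t *\<^sub>R v) + f x"
    have sw: "f (x + t *\<^sub>R v + t *\<^sub>R u) - f (x + t *\<^sub>R v) - f (x + t *\<^sub>R u) + f x = ?a"
      by (simp add: algebra_simps)
    have "norm (t\<^sup>2 *\<^sub>R (G v - H u)) = norm ((?a - t\<^sup>2 *\<^sub>R H u) - (?a - t\<^sup>2 *\<^sub>R G v))"
      by (simp add: algebra_simps)
    also have "\<dots> \<le> e / 2 * t\<^sup>2 + e / 2 * t\<^sup>2"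
      using d1(2)[OF t(1,2)] d2(2)[OF t(1,3)] unfolding sw
      by (rule order_trans[OF norm_triangle_ineq4 add_mono, rotated -1])
    finally show ?thesis using t by simp
  qed
  then have "norm (G v - H u) \<le> 0" by (rule field_le_epsilon) simp
  then show ?thesis by simp
qed

section \<open>Algebra of complex 4 by 4 matrices\<close>

lemma eq_minus_self_iff: "X = - X \<longleftrightarrow> X = 0" for X :: "'a::real_vector"
  by (metis add.inverse_neutral eq_neg_iff_add_eq_0 scaleR_2 scaleR_eq_0_iff zero_neq_numeral)

lemma scaleR_matrix_mult_left: "(r *\<^sub>R X) ** Y = r *\<^sub>R (X ** Y)" for X Y :: mat4
  by (simp add: vec_eq_iff matrix_matrix_mult_def scaleR_sum_right)

lemma scaleR_matrix_mult_right: "X ** (r *\<^sub>R Y) = r *\<^sub>R (X ** Y)" for X Y :: mat4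
  by (simp add: vec_eq_iff matrix_matrix_mult_def scaleR_sum_right)

lemma mat4_add_mult: "(X + Y) ** Z = X ** Z + Y ** Z" for X Y Z :: mat4
  by (simp add: vec_eq_iff matrix_matrix_mult_def sum.distrib distrib_right)

lemma bounded_bilinear_matrix_mult: "bounded_bilinear ((**) :: mat4 \<Rightarrow> mat4 \<Rightarrow> mat4)"
  unfolding bilinear_conv_bounded_bilinear[symmetric] bilinear_def
  by (auto intro!: linearI simp: matrix_add_ldistrib mat4_add_mult
      scaleR_matrix_mult_left scaleR_matrix_mult_right)

interpretation mat4_mult: bounded_bilinear "(**) :: mat4 \<Rightarrow> mat4 \<Rightarrow> mat4"
  by (rule bounded_bilinear_matrix_mult)

lemmas mat4_simps = matrix_mul_assoc
  mat4_mult.add_left mat4_mult.add_right mat4_mult.diff_left mat4_mult.diff_right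
  mat4_mult.minus_left mat4_mult.minus_right scaleR_matrix_mult_left scaleR_matrix_mult_right

section \<open>Differential calculus in a chart\<close>

definition regular_chart :: "'m chart \<Rightarrow> bool" where
  "regular_chart c \<longleftrightarrow> open (snd c ` fst c) \<and> inj_on (snd c) (fst c)"

text \<open>Tracked separately because \<open>dd\<close> rests on \<open>frechet_derivative\<close>,
  whose value is unspecified where no derivative exists.\<close>

definition diff_at :: "'m chart \<Rightarrow> ('m \<Rightarrow> 'b::real_normed_vector) \<Rightarrow> 'm \<Rightarrow> bool" where
  "diff_at c f p \<longleftrightarrow> (f \<circ> chart_inv c) differentiable (at (snd c p))"

lemma chart_inv_simps:
  assumes "regular_chart c"
  shows "p \<in> fst c \<Longrightarrow> chart_inv c (snd c p) = p"
    and "y \<in> snd c ` fst c \<Longrightarrow> snd c (chart_inv c y) = y"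
    and "y \<in> snd c ` fst c \<Longrightarrow> chart_inv c y \<in> fst c"
  using assms by (auto simp: regular_chart_def f_inv_into_f inv_into_into)

lemma diff_at_has_derivative:
  "diff_at c f p \<Longrightarrow> (f \<circ> chart_inv c has_derivative dd c f p) (at (snd c p))"
  unfolding diff_at_def dd_def frechet_derivative_works by simp

lemma dd_eqI:
  assumes "(f \<circ> chart_inv c has_derivative F) (at (snd c p))"
  shows "diff_at c f p" "dd c f p = F"
  using assms frechet_derivative_at[OF assms] by (auto simp: diff_at_def dd_def differentiable_def)

text \<open>Off the image of the chart, \<open>chart_inv\<close> takes unspecified values. The two
  coordinate representatives agree on the open image, which is enough since derivatives are
  local.\<close>

lemma dd_cong:
  assumes "regular_chart c" "p \<in> fst c" "\<And>x. x \<in> fst c \<Longrightarrow> f x = g x" "diff_at c g p"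
  shows "diff_at c f p" "dd c f p = dd c g p"
proof -
  have "(f \<circ> chart_inv c has_derivative dd c g p) (at (snd c p))"
    by (rule has_derivative_transform_within_open[OF diff_at_has_derivative[OF assms(4)],
          of "snd c ` fst c"])
      (use assms in \<open>auto simp: regular_chart_def\<close>)
  then show "diff_at c f p" "dd c f p = dd c g p" by (rule dd_eqI)+
qed

lemma dd_linear: "diff_at c f p \<Longrightarrow> linear (dd c f p)"
  by (rule has_derivative_linear[OF diff_at_has_derivative])

lemma dd_const: "diff_at c (\<lambda>x. k) p" "dd c (\<lambda>x. k) p = (\<lambda>v. 0)"
  using dd_eqI[of "\<lambda>x. k" c "\<lambda>v. 0" p] by (simp_all add: o_def)

lemma dd_add:
  assumes "diff_at c f p" "diff_at c g p"
  shows "diff_at c (\<lambda>x. f x + g x) p" "dd c (\<lambda>x. f x + g x) p = (\<lambda>v. dd c f p v + dd c g p v)"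
  using has_derivative_add[OF assms[THEN diff_at_has_derivative]]
  by (auto intro!: dd_eqI simp: o_def)

lemma dd_scaleR:
  assumes "diff_at c f p"
  shows "diff_at c (\<lambda>x. r *\<^sub>R f x) p" "dd c (\<lambda>x. r *\<^sub>R f x) p = (\<lambda>v. r *\<^sub>R dd c f p v)"
  using has_derivative_scaleR_right[OF diff_at_has_derivative[OF assms]]
  by (auto intro!: dd_eqI simp: o_def)

lemma dd_minus:
  assumes "diff_at c f p"
  shows "diff_at c (\<lambda>x. - f x) p" "dd c (\<lambda>x. - f x) p = (\<lambda>v. - dd c f p v)"
  using has_derivative_minus[OF diff_at_has_derivative[OF assms]]
  by (auto intro!: dd_eqI simp: o_def)

lemma dd_mult:
  fixes f g :: "'m \<Rightarrow> mat4"
  assumes "regular_chart c" "p \<in> fst c" "diff_at c f p" "diff_at c g p"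
  shows "diff_at c (\<lambda>x. f x ** g x) p"
    "dd c (\<lambda>x. f x ** g x) p = (\<lambda>v. f p ** dd c g p v + dd c f p v ** g p)"
  using mat4_mult.FDERIV[OF assms(3,4)[THEN diff_at_has_derivative]]
  by (auto intro!: dd_eqI simp: o_def chart_inv_simps[OF assms(1)] assms(2))

text \<open>The form is known to be differentiable only on fixed coordinate vectors, while the star
  inserts the moving vector \<open>J c x v\<close>. Expanding that vector in the standard basis
  leaves a finite sum of products of differentiable functions.\<close>

lemma diff_at_star:
  fixes J :: "('m, real^2) form1" and \<omega> :: "('m, 'b::real_normed_vector) form1"
  assumes "regular_chart c" "p \<in> fst c"
    and "\<And>v. diff_at c (\<lambda>x. J c x v) p" "\<And>v. diff_at c (\<lambda>x. \<omega> c x v) p"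
    and lin: "\<And>x. x \<in> fst c \<Longrightarrow> linear (\<omega> c x)"
  shows "diff_at c (\<lambda>x. star J \<omega> c x v) p"
proof (rule dd_cong(1)[OF assms(1,2)])
  show "star J \<omega> c x v = - (\<Sum>b\<in>Basis. (J c x v \<bullet> b) *\<^sub>R \<omega> c x b)" if "x \<in> fst c" for x
  proof -
    have "\<omega> c x (J c x v) = \<omega> c x (\<Sum>b\<in>Basis. (J c x v \<bullet> b) *\<^sub>R b)"
      by (simp add: euclidean_representation)
    also have "\<dots> = (\<Sum>b\<in>Basis. (J c x v \<bullet> b) *\<^sub>R \<omega> c x b)"
      using lin[OF that] by (simp only: linear_sum linear_scale)
    finally show ?thesis by (simp add: star_def)
  qed
  show "diff_at c (\<lambda>x. - (\<Sum>b\<in>Basis. (J c x v \<bullet> b) *\<^sub>R \<omega> c x b)) p"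
    using assms(3,4) unfolding diff_at_def o_def
    by (intro differentiable_minus differentiable_sum differentiable_scaleR differentiable_inner
        differentiable_const) auto
qed

text \<open>The coordinate form of d(df) = 0; it will make dS closed.\<close>

lemma dd_dd_symmetric:
  assumes c: "regular_chart c" "p \<in> fst c"
    and f: "\<And>x. x \<in> fst c \<Longrightarrow> diff_at c f x"
    and f2: "\<And>v. diff_at c (\<lambda>x. dd c f x v) p"
  shows "dd c (\<lambda>x. dd c f x v) p u = dd c (\<lambda>x. dd c f x u) p v"
proof (rule second_derivative_symmetric[where f = "f \<circ> chart_inv c" and x = "snd c p"
      and U = "snd c ` fst c" and f' = "\<lambda>y. dd c f (chart_inv c y)", symmetric])
  show "open (snd c ` fst c)" "snd c p \<in> snd c ` fst c"
    using c by (auto simp: regular_chart_def)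
  show "(f \<circ> chart_inv c has_derivative dd c f (chart_inv c y)) (at y)"
    if "y \<in> snd c ` fst c" for y
    using diff_at_has_derivative[OF f[OF chart_inv_simps(3)[OF c(1) that]]]
    by (simp add: chart_inv_simps[OF c(1)] that)
qed (use diff_at_has_derivative[OF f2] in \<open>simp_all add: o_def\<close>)

lemma smooth_on_diff_at:
  assumes "regular_chart c" "p \<in> fst c" "smooth_on (snd c ` fst c) (f \<circ> chart_inv c)"
  shows "diff_at c f p" "diff_at c (\<lambda>x. dd c f x v) p"
proof -
  let ?U = "snd c ` fst c" and ?f = "f \<circ> chart_inv c"
  have U: "open ?U" "snd c p \<in> ?U" using assms by (auto simp: regular_chart_def)
  have "Ck_on (Suc (Suc 0)) ?U ?f" using assms(3) unfolding smooth_on_def by blast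
  then have 1: "?f differentiable_on ?U"
    and 2: "(\<lambda>y. frechet_derivative ?f (at y) v) differentiable_on ?U"
    by auto
  show "diff_at c f p"
    using 1 U unfolding diff_at_def by (simp only: differentiable_on_eq_differentiable_at)
  have "(\<lambda>y. frechet_derivative ?f (at y) v) differentiable (at (snd c p))"
    using 2 U by (simp only: differentiable_on_eq_differentiable_at)
  then obtain F where F: "((\<lambda>y. frechet_derivative ?f (at y) v) has_derivative F) (at (snd c p))"
    by (auto simp: differentiable_def)
  have "((\<lambda>x. dd c f x v) \<circ> chart_inv c has_derivative F) (at (snd c p))"
    by (rule has_derivative_transform_within_open[OF F U])
      (simp add: dd_def chart_inv_simps[OF assms(1)])
  then show "diff_at c (\<lambda>x. dd c f x v) p" by (rule dd_eqI)
qed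

section \<open>The bracket of matrix-valued forms and the connection d - N\<close>

text \<open>Swapping the forms changes the sign twice, once in the commutator and once in the
  wedge.\<close>

lemma bracket_wedge_commute: "bracket_wedge \<mu> \<eta> c p u v = bracket_wedge \<eta> \<mu> c p u v"
  by (simp add: bracket_wedge_def commutator_def)

text \<open>Both sides are bilinear and alternating in the two tangent vectors, so they are compared
  on the basis u, Ju, where the left side is minus the sum of the commutators of
  \<open>\<mu>\<close> with \<open>\<eta>\<close> at u and at Ju.\<close>

lemma bracket_wedge_star_left:
  assumes J: "linear (J c p)" "\<And>v. J c p (J c p v) = - v"
      "\<And>v. v \<noteq> 0 \<Longrightarrow> det (vector [v, J c p v] :: real^2^2) > 0"
    and lin: "linear (\<mu> c p)" "linear (\<eta> c p)"
  shows "bracket_wedge (star J \<mu>) \<eta> c p u v = - bracket_wedge \<mu> (star J \<eta>) c p u v"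
proof (cases "u = 0")
  case True
  then show ?thesis
    using J lin by (simp add: bracket_wedge_def star_def commutator_def linear_0)
next
  case False
  define w where "w = J c p u"
  \<comment> \<open>The determinant of u and w. It is positive by the orientation of
    \<open>J\<close>, so the two vectors form a basis, and Cramer's rule gives the coefficients of
    v.\<close>
  define D where "D = u$1 * w$2 - u$2 * w$1"
  have D: "D > 0"
    using J(3)[OF False] by (simp add: w_def D_def det_2)
  obtain a b where v: "v = a *\<^sub>R u + b *\<^sub>R w"
  proof
    show "v = ((v$1 * w$2 - v$2 * w$1) / D) *\<^sub>R u + ((u$1 * v$2 - u$2 * v$1) / D) *\<^sub>R w"
      using D by (simp add: vec_eq_iff forall_2 field_simps) (simp add: D_def algebra_simps)
  qed
  have Jv: "J c p v = a *\<^sub>R w - b *\<^sub>R u"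
    using J by (simp add: v w_def linear_add linear_scale)
  show ?thesis
    unfolding bracket_wedge_def star_def Jv w_def[symmetric] unfolding v
    using lin by (simp add: linear_add linear_diff linear_scale commutator_def mat4_simps algebra_simps)
qed

lemma ext_D_eq: "ext_D S \<omega> c p u v = ext_d \<omega> c p u v - bracket_wedge (N_form S) \<omega> c p u v"
  by (simp add: ext_D_def ext_cov_def cov_def ext_d_def bracket_wedge_def commutator_def mat4_simps)

lemma anticommute_dd:
  fixes S :: "'m \<Rightarrow> mat4"
  assumes "regular_chart c" "p \<in> fst c" "diff_at c S p" "\<And>x. S x ** S x = - mat 1"
  shows "S p ** dd c S p v = - (dd c S p v ** S p)"
proof -
  have "dd c (\<lambda>x. S x ** S x) p v = 0" by (simp add: assms(4) dd_const)
  then show ?thesis by (simp add: dd_mult[OF assms(1,2,3,3)] eq_neg_iff_add_eq_0)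
qed

text \<open>\<open>S\<close> is parallel for d - N: since dS anti-commutes with \<open>S\<close>,
  the commutator of N with \<open>S\<close> is dS. The Leibniz rule then lets multiplication by
  \<open>S\<close> pass through the connection.\<close>

lemma cov_mult:
  fixes S \<xi> :: "'m \<Rightarrow> mat4"
  assumes "regular_chart c" "p \<in> fst c" "diff_at c S p" "diff_at c \<xi> p"
    "\<And>x. S x ** S x = - mat 1"
  shows "cov (\<lambda>c p v. - N_form S c p v) c (\<lambda>x. S x ** \<xi> x) p u
      = S p ** cov (\<lambda>c p v. - N_form S c p v) c \<xi> p u" (is ?left)
    and "cov (\<lambda>c p v. - N_form S c p v) c (\<lambda>x. \<xi> x ** S x) p u
      = cov (\<lambda>c p v. - N_form S c p v) c \<xi> p u ** S p" (is ?right)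
proof -
  define Y where "Y = dd c S p u"
  have 1: "S p ** (S p ** Z) = - Z" for Z :: mat4
    using assms(5)[of p] by (simp add: matrix_mul_assoc mat4_mult.minus_left)
  \<comment> \<open>The commutator of N with \<open>S\<close> is half of SYS + Y, so this identity
    makes it equal to \<open>Y\<close>.\<close>
  have SYS: "S p ** (Y ** S p) = Y"
    using anticommute_dd[OF assms(1,2,3,5), of u] 1[of Y]
    by (simp add: Y_def) (metis add.inverse_inverse mat4_mult.minus_right)
  then have 2: "S p ** (Y ** (S p ** Z)) = Y ** Z" for Z
    by (metis matrix_mul_assoc)
  \<comment> \<open>The Leibniz rule yields a full \<open>Y\<close> term on one side, of which the
    commutator cancels half; the other half matches the commutator on the opposite side.\<close>
  have half: "Z = (1/2) *\<^sub>R Z + (1/2) *\<^sub>R Z" for Z :: mat4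
    by (simp add: scaleR_add_left[symmetric])
  show ?left
    unfolding cov_def dd_mult(2)[OF assms(1-4)] commutator_def N_form_def Y_def[symmetric]
    using half[of "Y ** \<xi> p"]
    by (simp add: mat4_simps(2-) matrix_mul_assoc[symmetric] 1 2 algebra_simps)
  show ?right
    unfolding cov_def dd_mult(2)[OF assms(1,2,4,3)] commutator_def N_form_def Y_def[symmetric]
    using half[of "\<xi> p ** Y"]
    by (simp add: mat4_simps(2-) matrix_mul_assoc[symmetric] 1 SYS algebra_simps)
qed

section \<open>The equivalence at one point of a chart\<close>

text \<open>All the equations are tested at points and on fixed coordinate vectors, so a single
  point \<open>p\<close> is fixed. Identities that get differentiated at \<open>p\<close>, such as
  \<open>S_q\<close> and \<open>q_S\<close>, are assumed on the whole chart domain.\<close>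

locale constrained_Willmore_chart =
  fixes c :: "'m chart" and p :: 'm and J :: "('m, real^2) form1"
    and S :: "'m \<Rightarrow> mat4" and q :: "('m, mat4) form1"
  assumes chart: "regular_chart c" "p \<in> fst c"
    and J_linear: "\<And>x. x \<in> fst c \<Longrightarrow> linear (J c x)"
    and J_J: "\<And>x v. x \<in> fst c \<Longrightarrow> J c x (J c x v) = - v"
    and J_oriented: "\<And>v. v \<noteq> 0 \<Longrightarrow> det (vector [v, J c p v] :: real^2^2) > 0"
    and J_diff: "\<And>v. diff_at c (\<lambda>x. J c x v) p"
    and S_S: "\<And>x. S x ** S x = - mat 1"
    and S_diff: "\<And>x. x \<in> fst c \<Longrightarrow> diff_at c S x"
    and dS_diff: "\<And>v. diff_at c (\<lambda>x. dd c S x v) p"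
    and q_linear: "\<And>x. x \<in> fst c \<Longrightarrow> linear (q c x)"
    and q_diff: "\<And>v. diff_at c (\<lambda>x. q c x v) p"
    and S_q: "\<And>x v. x \<in> fst c \<Longrightarrow> S x ** q c x v = star J q c x v"
    and q_S: "\<And>x v. x \<in> fst c \<Longrightarrow> q c x v ** S x = star J q c x v"
begin

lemma S_S_mult: "S x ** (S x ** Z) = - Z" for Z :: mat4
  by (simp add: matrix_mul_assoc S_S mat4_mult.minus_left)

lemma mult_S_S: "Z ** S x ** S x = - Z" for Z :: mat4
  by (simp add: matrix_mul_assoc[symmetric] S_S mat4_mult.minus_right)

lemma N_linear: "x \<in> fst c \<Longrightarrow> linear (N_form S c x)"
  unfolding N_form_def using dd_linear[OF S_diff]
  by (auto intro!: linearI simp: linear_add linear_scale mat4_mult.add_right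
      scaleR_matrix_mult_right scaleR_add_right)

lemma N_diff: "diff_at c (\<lambda>x. N_form S c x v) p"
  unfolding N_form_def by (intro dd_scaleR dd_mult chart S_diff dS_diff)

lemma star_N_diff: "diff_at c (\<lambda>x. star J (N_form S) c x v) p"
  by (rule diff_at_star) (use chart J_diff N_diff N_linear in auto)

lemma star_q_diff: "diff_at c (\<lambda>x. star J q c x v) p"
  by (rule diff_at_star) (use chart J_diff q_diff q_linear in auto)

lemma S_N: "x \<in> fst c \<Longrightarrow> S x ** N_form S c x v = - (1/2) *\<^sub>R dd c S x v"
  by (simp add: N_form_def mat4_simps(2-) S_S_mult)

lemma N_anticommute: "x \<in> fst c \<Longrightarrow> N_form S c x v ** S x = - (S x ** N_form S c x v)"
  using arg_cong[OF anticommute_dd[OF chart(1) _ S_diff S_S, of x v], of "\<lambda>Z. S x ** Z"]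
  by (simp add: N_form_def scaleR_matrix_mult_left scaleR_matrix_mult_right mat4_mult.minus_right
      matrix_mul_assoc[symmetric])

lemma star_N_anticommute:
  "x \<in> fst c \<Longrightarrow> star J (N_form S) c x v ** S x = - (S x ** star J (N_form S) c x v)"
  by (simp add: star_def mat4_simps(2-) N_anticommute)

text \<open>Moving the star to the other factor costs a sign, and swapping the factors costs none,
  so the bracket equals its own negative.\<close>

lemma bracket_N_star_N: "bracket_wedge (N_form S) (star J (N_form S)) c p u v = 0"
proof -
  have "bracket_wedge (N_form S) (star J (N_form S)) c p u v
      = - bracket_wedge (N_form S) (star J (N_form S)) c p u v"
    using bracket_wedge_star_left[of J c p "N_form S" "N_form S" u v]
      J_linear J_J J_oriented N_linear chart(2)
    by (simp add: bracket_wedge_commute[of "star J (N_form S)"])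
  then show ?thesis by (simp only: eq_minus_self_iff)
qed

lemma ext_d_star_N:
  "ext_d (star J (N_form S)) c p u v = ext_D S (star J (N_form S)) c p u v"
  by (simp add: ext_D_eq bracket_N_star_N)

text \<open>Passing from d to the connection d - N costs the bracket of N with *q; moving the star
  onto N and swapping the factors turns it into minus the bracket of q with *N.\<close>

lemma ext_d_star_q:
  "ext_d (star J q) c p u v
    = ext_D S (star J q) c p u v - bracket_wedge q (star J (N_form S)) c p u v"
  using bracket_wedge_star_left[of J c p "N_form S" q u v]
    J_linear J_J J_oriented N_linear q_linear chart(2)
  by (simp add: ext_D_eq bracket_wedge_commute[of q])

abbreviation DD where "DD \<equiv> cov (\<lambda>c p v. - N_form S c p v) c"

lemma DD_cong:
  assumes "\<And>x. x \<in> fst c \<Longrightarrow> f x = g x" "diff_at c g p"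
  shows "DD f p u = DD g p u"
  using dd_cong(2)[OF chart assms] by (simp add: cov_def assms(1) chart(2))

text \<open>Rewriting *q as Sq or qS replaces a derivative of the star, which would involve
  derivatives of \<open>J\<close>, by multiplication with the parallel \<open>S\<close>.\<close>

lemma DD_star_q:
  "DD (\<lambda>x. star J q c x v) p u = S p ** DD (\<lambda>x. q c x v) p u"
  "DD (\<lambda>x. star J q c x v) p u = DD (\<lambda>x. q c x v) p u ** S p"
proof -
  note m = dd_mult(1)[OF chart] S_diff[OF chart(2)] q_diff
  have "DD (\<lambda>x. star J q c x v) p u = DD (\<lambda>x. S x ** q c x v) p u"
    by (rule DD_cong) (auto intro!: m simp: S_q)
  then show "DD (\<lambda>x. star J q c x v) p u = S p ** DD (\<lambda>x. q c x v) p u"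
    by (simp add: cov_mult(1)[OF chart S_diff[OF chart(2)] q_diff S_S])
  have "DD (\<lambda>x. star J q c x v) p u = DD (\<lambda>x. q c x v ** S x) p u"
    by (rule DD_cong) (auto intro!: m simp: q_S)
  then show "DD (\<lambda>x. star J q c x v) p u = DD (\<lambda>x. q c x v) p u ** S p"
    by (simp add: cov_mult(2)[OF chart S_diff[OF chart(2)] q_diff S_S])
qed

lemma ext_D_star_q:
  "ext_D S (star J q) c p u v = S p ** ext_D S q c p u v"
  "ext_D S (star J q) c p u v = ext_D S q c p u v ** S p"
  unfolding ext_D_def ext_cov_def
  by (simp add: DD_star_q(1) mat4_simps, simp add: DD_star_q(2) mat4_simps)

lemma ext_D_star_q_eq_0: "ext_D S (star J q) c p u v = 0 \<longleftrightarrow> ext_D S q c p u v = 0"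
  using S_S_mult[of p "ext_D S q c p u v"]
  by (auto simp: ext_D_star_q(1) mat4_mult.zero_right)

lemma ext_D_star_q_commute:
  "S p ** ext_D S (star J q) c p u v = ext_D S (star J q) c p u v ** S p"
  by (simp only: ext_D_star_q(1) matrix_mul_assoc[symmetric])
     (simp only: ext_D_star_q[symmetric])

text \<open>*N anti-commutes with \<open>S\<close>, and covariant differentiation preserves this
  because \<open>S\<close> is parallel.\<close>

lemma ext_D_star_N_anticommute:
  "S p ** ext_D S (star J (N_form S)) c p u v = - (ext_D S (star J (N_form S)) c p u v ** S p)"
proof -
  note m = dd_mult(1)[OF chart] S_diff[OF chart(2)] star_N_diff
  have "S p ** DD (\<lambda>x. star J (N_form S) c x v) p u
      = - (DD (\<lambda>x. star J (N_form S) c x v) p u ** S p)" for u v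
  proof -
    have "DD (\<lambda>x. star J (N_form S) c x v ** S x) p u
        = DD (\<lambda>x. - (S x ** star J (N_form S) c x v)) p u"
      by (rule DD_cong) (auto intro!: m dd_minus simp: star_N_anticommute)
    also have "\<dots> = - DD (\<lambda>x. S x ** star J (N_form S) c x v) p u"
      unfolding cov_def dd_minus(2)[OF m(1)[OF m(2,3)]] commutator_def
      by (simp add: mat4_simps)
    finally show ?thesis
      by (simp add: cov_mult[OF chart S_diff[OF chart(2)] star_N_diff S_S])
  qed
  then show ?thesis
    by (simp add: ext_D_def ext_cov_def mat4_simps(2-))
qed

text \<open>A product of a matrix commuting with \<open>S\<close>, here q, and one anti-commuting
  with it, here *N, anti-commutes with \<open>S\<close> in either order.\<close>

lemma bracket_q_star_N_anticommute:
  "S p ** bracket_wedge q (star J (N_form S)) c p u v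
    = - (bracket_wedge q (star J (N_form S)) c p u v ** S p)"
proof -
  have "S p ** commutator (q c p u) (star J (N_form S) c p v)
      = - (commutator (q c p u) (star J (N_form S) c p v) ** S p)" for u v
  proof -
    define X where "X = q c p u"
    define Y where "Y = star J (N_form S) c p v"
    have X: "S p ** X = X ** S p" using chart(2) by (simp add: X_def S_q q_S)
    have Y: "S p ** Y = - (Y ** S p)" using chart(2) by (simp add: Y_def star_N_anticommute)
    have 1: "S p ** (X ** Y) = - (X ** Y ** S p)"
      by (metis X Y mat4_mult.minus_right matrix_mul_assoc)
    have 2: "S p ** (Y ** X) = - (Y ** X ** S p)"
      by (metis X Y mat4_mult.minus_left matrix_mul_assoc)
    show ?thesis unfolding X_def[symmetric] Y_def[symmetric] commutator_def
      by (simp add: mat4_mult.diff_left mat4_mult.diff_right 1 2)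
  qed
  then show ?thesis by (simp add: bracket_wedge_def mat4_simps(2-))
qed

lemma constrained_Willmore_iff_at:
  "ext_D S q c p u v = 0 \<and>
   ext_D S (star J (N_form S)) c p u v = 2 *\<^sub>R bracket_wedge q (star J (N_form S)) c p u v
   \<longleftrightarrow> ext_d (star J (N_form S)) c p u v + 2 *\<^sub>R ext_d (star J q) c p u v = 0"
proof -
  define T where "T = ext_D S (star J (N_form S)) c p u v"
  define K where "K = bracket_wedge q (star J (N_form S)) c p u v"
  define E where "E = ext_D S (star J q) c p u v"
  define P where "P = T - 2 *\<^sub>R K"
  have P: "S p ** P = - (P ** S p)"
    using ext_D_star_N_anticommute[of u v] bracket_q_star_N_anticommute[of u v]
    by (simp add: P_def T_def K_def mat4_simps(2-))
  have E: "S p ** E = E ** S p" by (simp add: E_def ext_D_star_q_commute)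
  \<comment> \<open>If the sum vanishes, \<open>P\<close> is a multiple of \<open>E\<close> and so
    commutes with \<open>S\<close> as well as anti-commuting with it. Hence PS equals its own
    negative, and \<open>S\<close> is invertible.\<close>
  have "P = 0 \<and> E = 0" if sum: "P + 2 *\<^sub>R E = 0"
  proof -
    have eq: "P = - (2 *\<^sub>R E)" using sum by (simp add: eq_neg_iff_add_eq_0)
    have "S p ** P = P ** S p" using E by (simp add: eq mat4_simps(2-))
    then have "P ** S p = 0" using P by (metis eq_minus_self_iff)
    then have "P = 0" using mult_S_S[of P p] by (simp add: mat4_mult.zero_left)
    then show ?thesis using eq by simp
  qed
  moreover have "ext_d (star J (N_form S)) c p u v + 2 *\<^sub>R ext_d (star J q) c p u v = P + 2 *\<^sub>R E"
    by (simp add: ext_d_star_N ext_d_star_q P_def E_def T_def K_def algebra_simps)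
  ultimately show ?thesis
    unfolding ext_D_star_q_eq_0[symmetric] E_def[symmetric] T_def[symmetric] K_def[symmetric]
    by (auto simp: P_def)
qed

section \<open>The equations for the Hopf fields\<close>

text \<open>The star squares to -1, so the star of S*N is -SN, which is half of dS. The outer factor
  1/2 of the Hopf fields turns this into a quarter.\<close>

lemma star_hopf:
  assumes "x \<in> fst c"
  shows "star J (hopf_A J S) c x v = (1/2) *\<^sub>R star J (N_form S) c x v + (-1/4) *\<^sub>R dd c S x v"
    and "star J (hopf_Q J S) c x v = (1/2) *\<^sub>R star J (N_form S) c x v + (1/4) *\<^sub>R dd c S x v"
  using assms N_linear[OF assms] J_J[OF assms] S_N[OF assms]
  by (simp_all add: star_def hopf_A_def hopf_Q_def linear_neg algebra_simps mat4_simps(2-))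

text \<open>The coefficient \<open>r\<close> is free so that one computation serves both Hopf
  fields; its value drops out because dS is closed.\<close>

lemma ext_d_star_hopf_aux:
  assumes H: "\<And>x v. x \<in> fst c \<Longrightarrow>
    star J H c x v = (1/2) *\<^sub>R star J (N_form S) c x v + r *\<^sub>R dd c S x v"
  shows "ext_d (star J (\<lambda>c p v. H c p v + q c p v)) c p u v
    = (1/2) *\<^sub>R (ext_d (star J (N_form S)) c p u v + 2 *\<^sub>R ext_d (star J q) c p u v)"
proof -
  let ?N = "star J (N_form S)" and ?q = "star J q"
  note ds = dd_add dd_scaleR star_N_diff dS_diff star_q_diff
  have eq: "dd c (\<lambda>x. star J (\<lambda>c p v. H c p v + q c p v) c x v) p u =
      (1/2) *\<^sub>R dd c (\<lambda>x. ?N c x v) p u + r *\<^sub>R dd c (\<lambda>x. dd c S x v) p u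
      + dd c (\<lambda>x. ?q c x v) p u" for u v
  proof -
    have "dd c (\<lambda>x. star J (\<lambda>c p v. H c p v + q c p v) c x v) p =
        dd c (\<lambda>x. ((1/2) *\<^sub>R ?N c x v + r *\<^sub>R dd c S x v) + ?q c x v) p"
      by (rule dd_cong(2)[OF chart])
        (auto intro!: ds(1,3,5-) simp: H[symmetric], simp add: star_def)
    then show ?thesis by (simp add: ds)
  qed
  show ?thesis
    unfolding ext_d_def eq using dd_dd_symmetric[OF chart S_diff dS_diff, of v u]
    by (simp add: algebra_simps)
qed

lemmas ext_d_star_hopf = ext_d_star_hopf_aux[OF star_hopf(1)] ext_d_star_hopf_aux[OF star_hopf(2)]

end

theorem theorem9p13:
  fixes vol :: four_form
    and \<A> :: "'m::{t2_space, second_countable_topology} chart set"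
    and J :: "('m, real^2) form1"
    and L :: "'m \<Rightarrow> (complex^4) set"
    and S :: "'m \<Rightarrow> mat4"
    and q :: "('m, mat4) form1"
  assumes "admissible_det vol"
    and "oriented_surface \<A>"
    and "immersed_bundle vol \<A> L"
    and "induced_complex_structure vol \<A> L J"
    and "mean_curvature_sphere \<A> J L S"
    and "End_j_form \<A> L q"
    and "\<And>c p v. c \<in> \<A> \<Longrightarrow> p \<in> fst c \<Longrightarrow> S p ** q c p v = star J q c p v"
    and "\<And>c p v. c \<in> \<A> \<Longrightarrow> p \<in> fst c \<Longrightarrow> star J q c p v = q c p v ** S p"
  shows "(constrained_Willmore \<A> J S q \<longleftrightarrow>
            eq_form2 \<A> (\<lambda>c p u v. ext_d (star J (N_form S)) c p u v + 2 *\<^sub>R ext_d (star J q) c p u v)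
              (\<lambda>c p u v. 0))
       \<and> (constrained_Willmore \<A> J S q \<longleftrightarrow>
            eq_form2 \<A> (ext_d (star J (\<lambda>c p v. hopf_A J S c p v + q c p v))) (\<lambda>c p u v. 0))
       \<and> (constrained_Willmore \<A> J S q \<longleftrightarrow>
            eq_form2 \<A> (ext_d (star J (\<lambda>c p v. hopf_Q J S c p v + q c p v))) (\<lambda>c p u v. 0))"
proof -
  \<comment> \<open>Smoothness of \<open>J\<close>, \<open>S\<close> and \<open>q\<close> in each
    chart supplies the pointwise differentiability that the local argument asks for.\<close>
  have loc: "constrained_Willmore_chart c p J S q" if c: "c \<in> \<A>" and p: "p \<in> fst c" for c p
  proof -
    have hom: "open (snd c ` fst c)" "homeomorphism (fst c) (snd c ` fst c) (snd c) (chart_inv c)"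
      using assms(2) c by (auto simp: oriented_surface_def)
    have reg: "regular_chart c"
      using hom by (auto simp: regular_chart_def homeomorphism_def intro: inj_on_inverseI)
    have cs: "complex_structure \<A> J"
      using assms(4) by (simp add: induced_complex_structure_def)
    have J: "linear (J c x)" "J c x (J c x v) = - v"
        "v \<noteq> 0 \<Longrightarrow> det (vector [v, J c x v] :: real^2^2) > 0" if "x \<in> fst c" for x v
      using cs c that by (auto simp: complex_structure_def)
    have Jsm: "smooth_on (snd c ` fst c) ((\<lambda>x. J c x v) \<circ> chart_inv c)" for v
      using cs c by (auto simp: complex_structure_def o_def)
    have S: "smooth_on (snd c ` fst c) (S \<circ> chart_inv c)" "\<And>x. S x ** S x = - mat 1"
      using assms(5) c by (auto simp: mean_curvature_sphere_def smooth_map_def)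
    have q: "\<And>x. x \<in> fst c \<Longrightarrow> linear (q c x)"
        "\<And>v. smooth_on (snd c ` fst c) ((\<lambda>x. q c x v) \<circ> chart_inv c)"
      using assms(6) c by (auto simp: End_j_form_def one_form_def o_def)
    show ?thesis
    proof (rule constrained_Willmore_chart.intro)
      show "q c x v ** S x = star J q c x v" if "x \<in> fst c" for x v
        using assms(8)[OF c that] by simp
    qed (rule reg p J(1,2) J(3)[OF p] S(2) q(1) assms(7)[OF c] smooth_on_diff_at(1)[OF reg p Jsm]
        smooth_on_diff_at(1)[OF reg p q(2)] smooth_on_diff_at(1)[OF reg _ S(1)]
        smooth_on_diff_at(2)[OF reg p S(1)]; assumption)+
  qed
  have i: "constrained_Willmore \<A> J S q \<longleftrightarrow>
      eq_form2 \<A> (\<lambda>c p u v. ext_d (star J (N_form S)) c p u v + 2 *\<^sub>R ext_d (star J q) c p u v)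
        (\<lambda>c p u v. 0)"
    unfolding constrained_Willmore_def eq_form2_def
    using constrained_Willmore_chart.constrained_Willmore_iff_at[OF loc] by (fast)
  \<comment> \<open>The 2-forms of (ii) and (iii) are each one half of the one in (i), so the three
    vanish together.\<close>
  then show ?thesis
    using constrained_Willmore_chart.ext_d_star_hopf[OF loc]
    by (simp add: eq_form2_def)
qed

end
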